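(* Let $K\in\mathbb{R}^{m\times n}$ be strictly stabilizing for $(A,B)$ and let $\{w_t\}$ be WSS or NRM. Then under the output feedback $u_t=K\hat x_t$ with the Kalman filter estimate $\hat x_t$, the covariance of $\{\hat x_t\}_{t\in\mathbb{N}}$ converges to a unique stationary value $\bar S\succeq0$ that satisfies the discrete-time Lyapunov equation $$\bar S=(A+BK)\bar S(A+BK)^{\top}+(LC)E(LC)^{\top}+LVL^{\top}.$$ Moreover, the covariance of the state $\{x_t\}_{t\in\mathbb{N}}$ converges to a unique stationary value $\bar X\succ0$ that satisfies $$\bar X=\bar S+E .$$
   Context: Consider the system $x_{t+1}=Ax_t+Bu_t+w_t$, $y_t=Cx_t+v_t$ with $A\in\mathbb{R}^{n\times n}$, $B\in\mathbb{R}^{n\times m}$, $C\in\mathbb{R}^{p\times n}$, fixed initial condition $x_0\in\mathbb{R}^n$, $(A,B)$ stabilizable and $(A,C)$ observable. The disturbances $\{w_t\}$ and the measurement noise $\{v_t\}$ (with $v_t\in\mathbb{R}^p$) are white noise processes, uncorrelated with each other, with zero mean and common finite covariances $W=\mathbf{E}[w_tw_t^{\top}]\succ0$ and $V=\mathbf{E}[v_tv_t^{\top}]\succ0$. "WSS" (wide-sense stationary) means that only these first two moments are specified; "NRM" means that in addition all terms are identically normally distributed. $K$ is strictly stabilizing if all eigenvalues of $A+BK$ have modulus less than $1$. The state estimator is $\hat x_{t+1}=A\hat x_t+Bu_t+L(y_t-C\hat x_t)$ with fixed (deterministic) $\hat x_0$, estimation error $e_t:=x_t-\hat x_t$, and input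 $u_t=K\hat x_t$. $L\in\mathbb{R}^{n\times p}$ is the stationary Kalman filter gain: $E\succ 0$ is the (stabilizing) solution of $E=AEA^{\top}-AEC^{\top}(CEC^{\top}+V)^{-1}CEA^{\top}+W$ and $L=AEC^{\top}(CEC^{\top}+V)^{-1}$; $E$ is the stationary covariance of the estimation error. The Kalman filter has the (known) property that, in stationary operation, $e_t$ and $\hat x_t$ are uncorrelated, $\mathbf{E}[e_t\hat x_t^{\top}]=0$. $\succeq$ denotes the semidefinite ordering. *)

theory Defs
  imports "HOL-Probability.Probability"
begin

section \<open>Matrices\<close>

definition pos_semidef :: "real^'n^'n \<Rightarrow> bool" where
  "pos_semidef A \<longleftrightarrow> transpose A = A \<and> (\<forall>x. 0 \<le> x \<bullet> (A *v x))"

definition pos_def :: "real^'n^'n \<Rightarrow> bool" where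
  "pos_def A \<longleftrightarrow> transpose A = A \<and> (\<forall>x. x \<noteq> 0 \<longrightarrow> 0 < x \<bullet> (A *v x))"

text \<open>Eigenvalues of a real matrix are taken over the complex numbers.\<close>

definition eigenvalue :: "real^'n^'n \<Rightarrow> complex \<Rightarrow> bool" where
  "eigenvalue A l \<longleftrightarrow>
     (\<exists>v :: complex^'n. v \<noteq> 0 \<and> map_matrix complex_of_real A *v v = l *s v)"

definition schur_stable :: "real^'n^'n \<Rightarrow> bool" where
  "schur_stable A \<longleftrightarrow> (\<forall>l. eigenvalue A l \<longrightarrow> cmod l < 1)"

section \<open>Linear systems\<close>

definition strictly_stabilizing :: "real^'n^'n \<Rightarrow> real^'m^'n \<Rightarrow> real^'n^'m \<Rightarrow> bool" where
  "strictly_stabilizing A B K \<longleftrightarrow> schur_stable (A + B ** K)"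

definition stabilizable :: "real^'n^'n \<Rightarrow> real^'m^'n \<Rightarrow> bool" where
  "stabilizable A B \<longleftrightarrow> (\<exists>K. strictly_stabilizing A B K)"

text \<open>The outputs of the unforced, noise-free system over some finite horizon determine the
  initial state.\<close>

definition observable :: "real^'n^'n \<Rightarrow> real^'n^'p \<Rightarrow> bool" where
  "observable A C \<longleftrightarrow>
     (\<exists>T. \<forall>x x'. (\<forall>t<T. C *v (((*v) A ^^ t) x) = C *v (((*v) A ^^ t) x')) \<longrightarrow> x = x')"

section \<open>Random vectors and noise processes\<close>

definition outer_prod :: "real^'n \<Rightarrow> real^'k \<Rightarrow> real^'k^'n" where
  "outer_prod x y = (\<chi> i j. x $ i * y $ j)"

definition covariance :: "'a measure \<Rightarrow> ('a \<Rightarrow> real^'n) \<Rightarrow> real^'n^'n" where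
  "covariance M X =
     integral\<^sup>L M (\<lambda>\<omega>. outer_prod (X \<omega> - integral\<^sup>L M X) (X \<omega> - integral\<^sup>L M X))"

text \<open>Square integrability makes all the second moments below genuine (finite) integrals.\<close>

definition wss_noise :: "'a measure \<Rightarrow> (nat \<Rightarrow> 'a \<Rightarrow> real^'n) \<Rightarrow> real^'n^'n \<Rightarrow> bool" where
  "wss_noise M w W \<longleftrightarrow>
     (\<forall>t. w t \<in> borel_measurable M \<and> integrable M (\<lambda>\<omega>. (norm (w t \<omega>))\<^sup>2)) \<and>
     (\<forall>t. integral\<^sup>L M (w t) = 0) \<and>
     (\<forall>t. integral\<^sup>L M (\<lambda>\<omega>. outer_prod (w t \<omega>) (w t \<omega>)) = W) \<and>
     (\<forall>s t. s \<noteq> t \<longrightarrow> integral\<^sup>L M (\<lambda>\<omega>. outer_prod (w s \<omega>) (w t \<omega>)) = 0)"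

text \<open>Density of the normal distribution with mean 0 and covariance matrix W;
  meaningful for positive definite W.\<close>

definition mvn_density :: "real^'n^'n \<Rightarrow> real^'n \<Rightarrow> real" where
  "mvn_density W x =
     exp (- (x \<bullet> (matrix_inv W *v x)) / 2) / sqrt ((2 * pi) ^ CARD('n) * det W)"

definition nrm_noise :: "'a measure \<Rightarrow> (nat \<Rightarrow> 'a \<Rightarrow> real^'n) \<Rightarrow> real^'n^'n \<Rightarrow> bool" where
  "nrm_noise M w W \<longleftrightarrow>
     wss_noise M w W \<and> (\<forall>t. distributed M lborel (w t) (\<lambda>x. ennreal (mvn_density W x)))"

definition uncorrelated_processes ::
  "'a measure \<Rightarrow> (nat \<Rightarrow> 'a \<Rightarrow> real^'n) \<Rightarrow> (nat \<Rightarrow> 'a \<Rightarrow> real^'k) \<Rightarrow> bool" where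
  "uncorrelated_processes M w v \<longleftrightarrow>
     (\<forall>s t. integral\<^sup>L M (\<lambda>\<omega>. outer_prod (w s \<omega> - integral\<^sup>L M (w s))
                                     (v t \<omega> - integral\<^sup>L M (v t))) = 0)"

section \<open>Kalman filter and closed loop\<close>

definition kalman_gain ::
  "real^'n^'n \<Rightarrow> real^'n^'p \<Rightarrow> real^'p^'p \<Rightarrow> real^'n^'n \<Rightarrow> real^'p^'n" where
  "kalman_gain A C V E =
     A ** E ** transpose C ** matrix_inv (C ** E ** transpose C + V)"

text \<open>The stabilizing solution of the filter Riccati equation: the error dynamics matrix
  A - L C for the resulting gain L is Schur stable.\<close>

definition kalman_error_cov ::
  "real^'n^'n \<Rightarrow> real^'n^'p \<Rightarrow> real^'n^'n \<Rightarrow> real^'p^'p \<Rightarrow> real^'n^'n \<Rightarrow> bool" where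
  "kalman_error_cov A C W V E \<longleftrightarrow>
     pos_def E \<and>
     E = A ** E ** transpose A
         - A ** E ** transpose C ** matrix_inv (C ** E ** transpose C + V) ** C ** E ** transpose A
         + W \<and>
     schur_stable (A - kalman_gain A C V E ** C)"

definition kalman_closed_loop ::
  "'a measure \<Rightarrow> real^'n^'n \<Rightarrow> real^'m^'n \<Rightarrow> real^'n^'p \<Rightarrow> real^'n^'m \<Rightarrow> real^'p^'n \<Rightarrow>
   (nat \<Rightarrow> 'a \<Rightarrow> real^'n) \<Rightarrow> (nat \<Rightarrow> 'a \<Rightarrow> real^'p) \<Rightarrow> real^'n \<Rightarrow> real^'n \<Rightarrow>
   (nat \<Rightarrow> 'a \<Rightarrow> real^'n) \<Rightarrow> (nat \<Rightarrow> 'a \<Rightarrow> real^'n) \<Rightarrow>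
   (nat \<Rightarrow> 'a \<Rightarrow> real^'m) \<Rightarrow> (nat \<Rightarrow> 'a \<Rightarrow> real^'p) \<Rightarrow> bool" where
  "kalman_closed_loop M A B C K L w v x0 xh0 x xh u y \<longleftrightarrow>
     (\<forall>\<omega>\<in>space M.
        x 0 \<omega> = x0 \<and> xh 0 \<omega> = xh0 \<and>
        (\<forall>t. x (Suc t) \<omega> = A *v x t \<omega> + B *v u t \<omega> + w t \<omega> \<and>
             y t \<omega> = C *v x t \<omega> + v t \<omega> \<and>
             xh (Suc t) \<omega> = A *v xh t \<omega> + B *v u t \<omega> + L *v (y t \<omega> - C *v xh t \<omega>) \<and>
             u t \<omega> = K *v xh t \<omega>))"

definition estimate_lyapunov ::
  "real^'n^'n \<Rightarrow> real^'m^'n \<Rightarrow> real^'n^'p \<Rightarrow> real^'n^'m \<Rightarrow> real^'p^'n \<Rightarrow>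
   real^'n^'n \<Rightarrow> real^'p^'p \<Rightarrow> real^'n^'n \<Rightarrow> bool" where
  "estimate_lyapunov A B C K L E V S \<longleftrightarrow>
     S = (A + B ** K) ** S ** transpose (A + B ** K)
         + (L ** C) ** E ** transpose (L ** C)
         + L ** V ** transpose L"

end

theory Submission
  imports Defs "HOL-Computational_Algebra.Fundamental_Theorem_Algebra"
begin

text \<open>
  Write \<open>e = x - xh\<close> for the estimation error and put \<open>F = A + B K\<close>, \<open>G = A - L C\<close>,
  \<open>H = L C\<close>. Substituting the output into the filter gives
    \<open>e\<^sub>t\<^sub>+\<^sub>1 = G e\<^sub>t + w\<^sub>t - L v\<^sub>t\<close> and \<open>xh\<^sub>t\<^sub>+\<^sub>1 = F xh\<^sub>t + H e\<^sub>t + L v\<^sub>t\<close>.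
  Both \<open>F\<close> and \<open>G\<close> are Schur stable, the former by the choice of \<open>K\<close> and the latter because
  \<open>E\<close> is the stabilizing solution of the Riccati equation.
  The noise at time \<open>t\<close> is uncorrelated with \<open>e\<^sub>t\<close> and \<open>xh\<^sub>t\<close>, which depend only on earlier
  noise, so the covariance \<open>P\<close> of \<open>e\<close>, the cross covariance \<open>Q\<close> of \<open>e\<close> and \<open>xh\<close>, and the
  covariance \<open>S\<close> of \<open>xh\<close> satisfy the closed system of linear recursions
    \<open>P' = G P G\<^sup>T + W + L V L\<^sup>T\<close>,
    \<open>Q' = G Q F\<^sup>T + G P H\<^sup>T - L V L\<^sup>T\<close>,
    \<open>S' = F S F\<^sup>T + F Q\<^sup>T H\<^sup>T + H Q F\<^sup>T + H P H\<^sup>T + L V L\<^sup>T\<close>.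

  The Kalman gain enters through two identities (\<open>kalman_gain_identities\<close>):
  \<open>E = G E G\<^sup>T + W + L V L\<^sup>T\<close> and \<open>G E H\<^sup>T = L V L\<^sup>T\<close>. By the first, \<open>P\<close> tends to \<open>E\<close>;
  by the second, the forcing term of \<open>Q\<close> then tends to zero, and so does \<open>Q\<close>; what is left in the
  limit of the third recursion is the Lyapunov equation for the estimate. As \<open>x = xh + e\<close>, the
  covariance of the state is \<open>S + Q + Q\<^sup>T + P\<close>, which tends to the solution plus \<open>E\<close>. Thus
  the orthogonality of error and estimate, familiar from stationary operation, is reached in the
  limit from arbitrary deterministic initial values (\<open>covariance_limits\<close>).

  Everything rests on one fact (\<open>schur_stable_recursion_null\<close>): if \<open>F\<close> and \<open>G\<close> are Schur stable
  and \<open>X\<^sub>t\<^sub>+\<^sub>1 = F X\<^sub>t G\<^sup>T + D\<^sub>t\<close> with \<open>D\<close> tending to zero, then \<open>X\<close> tends to zero. Over the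
  complex numbers, \<open>F\<close> is annihilated by a product of factors \<open>F - l\<close>, and removing these factors
  one at a time replaces \<open>F\<close>, and then \<open>G\<close>, by single eigenvalues. The same fact yields existence,
  uniqueness and semidefiniteness of the solution of the Lyapunov equation.
\<close>

section \<open>Matrix algebra\<close>

lemma matrix_add_rdistrib: "(A + B) ** C = A ** C + B ** C"
  by (vector matrix_matrix_mult_def sum.distrib[symmetric] field_simps)

lemma matrix_diff_ldistrib:
  fixes A :: "'a::ring_1^'n^'m"
  shows "A ** (B - C) = A ** B - A ** C"
  by (vector matrix_matrix_mult_def sum_subtractf[symmetric] algebra_simps)

lemma matrix_diff_rdistrib:
  fixes A :: "'a::ring_1^'n^'m"
  shows "(A - B) ** C = A ** C - B ** C"
  by (vector matrix_matrix_mult_def sum_subtractf[symmetric] algebra_simps)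

lemma matrix_neg_left: "(- A) ** B = - (A ** B)" for A :: "real^'b^'c" and B :: "real^'d^'b"
  by (simp add: matrix_matrix_mult_def vec_eq_iff sum_negf)

lemma matrix_neg_right: "A ** (- B) = - (A ** B)" for A :: "real^'b^'c" and B :: "real^'d^'b"
  by (simp add: matrix_matrix_mult_def vec_eq_iff sum_negf)

lemma transpose_neg: "transpose (- A) = - transpose A" for A :: "real^'b^'c"
  by (simp add: transpose_def vec_eq_iff)

lemma matrix_sum_rdistrib: "sum f S ** C = (\<Sum>i\<in>S. f i ** C)"
  by (induction S rule: infinite_finite_induct) (auto simp: matrix_add_rdistrib)

lemma transpose_add: "transpose (A + B) = transpose A + transpose B"
  by (simp add: transpose_def vec_eq_iff)

lemma transpose_diff: "transpose (A - B) = transpose A - transpose B"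
  by (simp add: transpose_def vec_eq_iff)

lemma transpose_zero [simp]: "transpose 0 = 0"
  by (simp add: transpose_def vec_eq_iff)

lemma mat_mult_component:
  fixes X :: "'a::comm_semiring_1^'k^'n"
  shows "(mat c ** X) $ i $ j = c * X $ i $ j" "(X ** mat c) $ i $ j = c * X $ i $ j"
proof -
  have "(\<Sum>k\<in>UNIV. (if i = k then c else 0) * X $ k $ j) = c * X $ i $ j"
    by (subst sum.remove[of _ i]) (auto intro!: sum.neutral)
  then show "(mat c ** X) $ i $ j = c * X $ i $ j"
    by (simp add: matrix_matrix_mult_def mat_def)
  have "(\<Sum>k\<in>UNIV. X $ i $ k * (if k = j then c else 0)) = c * X $ i $ j"
    by (subst sum.remove[of _ j]) (auto intro!: sum.neutral simp: mult.commute)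
  then show "(X ** mat c) $ i $ j = c * X $ i $ j"
    by (simp add: matrix_matrix_mult_def mat_def)
qed

lemma mat_commute:
  fixes X :: "'a::comm_semiring_1^'k^'n"
  shows "mat c ** X = X ** mat c"
  by (simp add: vec_eq_iff mat_mult_component)

lemma tendsto_matrix_mult:
  fixes f :: "'b \<Rightarrow> 'a::real_normed_field^'n^'m" and g :: "'b \<Rightarrow> 'a^'k^'n"
  assumes "(f \<longlongrightarrow> a) Z" "(g \<longlongrightarrow> b) Z"
  shows "((\<lambda>x. f x ** g x) \<longlongrightarrow> a ** b) Z"
  unfolding matrix_matrix_mult_def
  by (intro vec_tendstoI)
    (auto intro!: tendsto_sum tendsto_mult tendsto_vec_nth[OF tendsto_vec_nth] assms)

lemma tendsto_transpose:
  fixes f :: "'b \<Rightarrow> 'a::real_normed_vector^'n^'m"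
  assumes "(f \<longlongrightarrow> a) Z"
  shows "((\<lambda>x. transpose (f x)) \<longlongrightarrow> transpose a) Z"
  unfolding transpose_def
  by (intro vec_tendstoI) (auto intro!: tendsto_vec_nth[OF tendsto_vec_nth] assms)

section \<open>Annihilating polynomials\<close>

primrec matrix_power :: "'a::semiring_1^'n^'n \<Rightarrow> nat \<Rightarrow> 'a^'n^'n" where
  "matrix_power F 0 = mat 1"
| "matrix_power F (Suc i) = matrix_power F i ** F"

definition matrix_poly :: "'a::comm_ring_1 poly \<Rightarrow> 'a^'n^'n \<Rightarrow> 'a^'n^'n" where
  "matrix_poly p F = (\<Sum>i\<le>degree p. mat (coeff p i) ** matrix_power F i)"

lemma mat_diff:
  fixes a :: "'a::ring_1"
  shows "mat (a - b) = mat a - mat b"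
  by (simp add: mat_def vec_eq_iff)

lemma mat_times:
  fixes a :: "'a::comm_semiring_1"
  shows "mat (a * b) = mat a ** mat b"
  by (simp add: vec_eq_iff mat_mult_component(1)) (simp add: mat_def)

lemma matrix_poly_bound:
  assumes "degree p \<le> n"
  shows "matrix_poly p F = (\<Sum>i\<le>n. mat (coeff p i) ** matrix_power F i)"
  unfolding matrix_poly_def
  by (rule sum.mono_neutral_left) (use assms in \<open>auto simp: coeff_eq_0\<close>)

lemma matrix_poly_diff: "matrix_poly (p - q) F = matrix_poly p F - matrix_poly q F"
proof -
  define n where "n = max (degree p) (degree q)"
  have "degree (p - q) \<le> n" "degree p \<le> n" "degree q \<le> n"
    by (auto simp: n_def degree_diff_le_max)
  then show ?thesis
    by (simp add: matrix_poly_bound[of _ n] mat_diff matrix_diff_rdistrib sum_subtractf)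
qed

lemma matrix_poly_smult: "matrix_poly (smult c p) F = matrix_poly p F ** mat c"
proof -
  have "matrix_poly (smult c p) F = (\<Sum>i\<le>degree p. mat (coeff p i) ** matrix_power F i ** mat c)"
    unfolding matrix_poly_bound[OF degree_smult_le]
    by (intro sum.cong refl) (metis coeff_smult mat_commute mat_times matrix_mul_assoc mult.commute)
  then show ?thesis
    by (simp add: matrix_poly_def matrix_sum_rdistrib)
qed

lemma matrix_poly_pCons: "matrix_poly (pCons a p) F = mat a + matrix_poly p F ** F"
proof -
  have "matrix_poly (pCons a p) F =
      (\<Sum>i\<le>Suc (degree p). mat (coeff (pCons a p) i) ** matrix_power F i)"
    by (rule matrix_poly_bound[OF degree_pCons_le])
  also have "\<dots> = mat a + (\<Sum>i\<le>degree p. mat (coeff p i) ** matrix_power F (Suc i))"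
    by (subst sum.atMost_Suc_shift) simp
  finally show ?thesis
    by (simp add: matrix_poly_def matrix_sum_rdistrib matrix_mul_assoc)
qed

lemma matrix_poly_linear_factor:
  "matrix_poly ([:- z, 1:] * q) F = matrix_poly q F ** (F - mat z)"
proof -
  have "[:- z, 1:] * q = pCons 0 q - smult z q"
    by simp
  then show ?thesis
    by (simp only: matrix_poly_diff matrix_poly_pCons matrix_poly_smult matrix_diff_ldistrib mat_0 add_0)
qed

text \<open>
  \<^term>\<open>shift_product F ls X\<close> is the product of the factors \<^term>\<open>F - mat l\<close> applied to
  \<^term>\<open>X\<close>. The head of the list acts first, so that an induction on the list peels off the
  factor next to \<^term>\<open>X\<close>.
\<close>

primrec shift_product :: "'a::comm_ring_1^'n^'n \<Rightarrow> 'a list \<Rightarrow> 'a^'k^'n \<Rightarrow> 'a^'k^'n" where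
  "shift_product F [] X = X"
| "shift_product F (l # ls) X = shift_product F ls ((F - mat l) ** X)"

text \<open>
  The fundamental theorem of algebra, transported to matrices: each root of the polynomial
  contributes one shift, and the leading coefficient is what remains.
\<close>

lemma matrix_poly_splits:
  fixes p :: "complex poly"
  assumes "p \<noteq> 0"
  shows "\<exists>c ls. c \<noteq> 0 \<and> (\<forall>X::complex^'k^'n. matrix_poly p F ** X = mat c ** shift_product F ls X)"
  using assms
proof (induction "degree p" arbitrary: p)
  case 0
  then obtain a where "p = [:a:]" "a \<noteq> 0"
    by (metis degree_eq_zeroE pCons_0_0)
  then show ?case
    by (intro exI[of _ a] exI[of _ "[]"]) (simp add: matrix_poly_def)
next
  case (Suc d)
  then obtain z where "poly p z = 0"
    using fundamental_theorem_of_algebra constant_degree by (metis nat.distinct(1))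
  then obtain q where q: "p = [:- z, 1:] * q"
    by (auto simp: poly_eq_0_iff_dvd elim: dvdE)
  with Suc.prems have "q \<noteq> 0" by auto
  moreover have "degree q = d"
    using Suc.hyps(2) \<open>q \<noteq> 0\<close> unfolding q by (subst (asm) degree_mult_eq) auto
  ultimately obtain c ls where "c \<noteq> 0"
    and "\<And>X::complex^'k^'n. matrix_poly q F ** X = mat c ** shift_product F ls X"
    using Suc.hyps(1) by blast
  then show ?case
    by (intro exI[of _ c] exI[of _ "z # ls"])
      (simp only: q matrix_poly_linear_factor matrix_mul_assoc[symmetric] shift_product.simps, simp)
qed

text \<open>
  Stated for families rather than sets, because the powers of a matrix may repeat; a repetition
  is itself a linear relation.
\<close>

lemma DIM_Suc_family_dependent:
  fixes f :: "nat \<Rightarrow> 'v::euclidean_space"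
  obtains a :: "nat \<Rightarrow> real" and k where "k \<le> DIM('v)" "a k \<noteq> 0"
    "(\<Sum>i\<le>DIM('v). a i *\<^sub>R f i) = 0"
proof (cases "inj_on f {..DIM('v)}")
  case False
  then obtain i j where ij: "i \<le> DIM('v)" "j \<le> DIM('v)" "i \<noteq> j" "f i = f j"
    by (auto simp: inj_on_def)
  let ?a = "\<lambda>k. (if k = i then 1 else 0) - (if k = j then 1 else 0) :: real"
  have "(\<Sum>k\<le>DIM('v). ?a k *\<^sub>R f k) =
      (\<Sum>k\<le>DIM('v). (if k = i then f k else 0)) - (\<Sum>k\<le>DIM('v). (if k = j then f k else 0))"
    unfolding sum_subtractf[symmetric] by (intro sum.cong) auto
  also have "\<dots> = 0"
    using ij by simp
  finally show ?thesis
    using ij that[of i ?a] by simp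
next
  case True
  let ?S = "f ` {..DIM('v)}"
  have "card ?S > DIM('v)"
    using card_image[OF True] by simp
  then have "dependent ?S"
    by (rule dependent_biggerset)
  then obtain u v where u: "v \<in> ?S" "u v \<noteq> 0" "(\<Sum>w\<in>?S. u w *\<^sub>R w) = 0"
    by (auto simp: dependent_finite)
  then obtain k where "k \<le> DIM('v)" "v = f k" by auto
  moreover have "(\<Sum>i\<le>DIM('v). u (f i) *\<^sub>R f i) = 0"
    using u(3) by (subst (asm) sum.reindex[OF True]) simp
  ultimately show ?thesis
    using that[of k "u \<circ> f"] u(2) by simp
qed

text \<open>
  The powers of \<^term>\<open>F\<close> live in a finite-dimensional real space, so some nonzero polynomial
  annihilates \<^term>\<open>F\<close>; splitting it into linear factors gives the list.
\<close>

lemma annihilating_shift_product: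
  fixes F :: "complex^'n^'n"
  shows "\<exists>ls. \<forall>X::complex^'k^'n. shift_product F ls X = 0"
proof -
  define N where "N = DIM(complex^'n^'n)"
  obtain a :: "nat \<Rightarrow> real" and k where a: "k \<le> N" "a k \<noteq> 0"
    "(\<Sum>i\<le>N. a i *\<^sub>R matrix_power F i) = 0"
    unfolding N_def by (rule DIM_Suc_family_dependent)
  define p where "p = (\<Sum>i\<le>N. monom (complex_of_real (a i)) i)"
  have c: "coeff p i = (if i \<le> N then of_real (a i) else 0)" for i
    by (simp add: p_def coeff_sum)
  then have "p \<noteq> 0"
    using a by (metis coeff_0 of_real_eq_0_iff)
  then obtain c ls where ls: "c \<noteq> 0"
    "\<And>X::complex^'k^'n. matrix_poly p F ** X = mat c ** shift_product F ls X"
    using matrix_poly_splits by blast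
  have "degree p \<le> N"
    by (rule degree_le) (simp add: c)
  then have "matrix_poly p F = (\<Sum>i\<le>N. a i *\<^sub>R matrix_power F i)"
    by (simp add: matrix_poly_bound c vec_eq_iff mat_mult_component scaleR_conv_of_real[where 'a = complex])
  then have "mat c ** shift_product F ls X = 0" for X :: "complex^'k^'n"
    using a(3) ls(2)[of X] by simp
  then have "shift_product F ls X = 0" for X :: "complex^'k^'n"
    using ls(1) by (simp add: vec_eq_iff mat_mult_component)
  then show ?thesis
    by blast
qed

section \<open>Perturbed stable recursions\<close>

lemma scalar_recursion_null:
  fixes z d :: "nat \<Rightarrow> complex"
  assumes rec: "\<And>t. z (Suc t) = l * z t + d t" and d: "d \<longlonglongrightarrow> 0" and l: "cmod l < 1"
  shows "z \<longlonglongrightarrow> 0"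
proof (rule LIMSEQ_I)
  fix e :: real assume "e > 0"
  define \<delta> where "\<delta> = e / 2 * (1 - cmod l)"
  have "\<delta> > 0"
    using \<open>e > 0\<close> l by (simp add: \<delta>_def)
  then obtain T where T: "\<And>t. t \<ge> T \<Longrightarrow> cmod (d t) < \<delta>"
    using LIMSEQ_D[OF d, of \<delta>] by auto
  \<comment> \<open>\<open>\<delta>\<close> is chosen such that \<open>e / 2\<close> is the fixed point of the majorant \<open>a \<mapsto> \<bar>l\<bar> a + \<delta>\<close>\<close>
  have bound: "cmod (z (T + k)) \<le> cmod l ^ k * cmod (z T) + e / 2" for k
  proof (induction k)
    case 0
    then show ?case using \<open>e > 0\<close> by simp
  next
    case (Suc k)
    have "cmod (z (T + Suc k)) \<le> cmod l * cmod (z (T + k)) + cmod (d (T + k))"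
      using norm_triangle_ineq[of "l * z (T + k)" "d (T + k)"] by (simp add: rec norm_mult)
    also have "\<dots> \<le> cmod l * (cmod l ^ k * cmod (z T) + e / 2) + \<delta>"
      by (intro add_mono mult_left_mono Suc.IH less_imp_le[OF T]) auto
    also have "\<dots> = cmod l ^ Suc k * cmod (z T) + e / 2"
      by (simp add: \<delta>_def field_simps)
    finally show ?case .
  qed
  have "(\<lambda>k. cmod l ^ k * cmod (z T)) \<longlonglongrightarrow> 0 * cmod (z T)"
    by (intro tendsto_mult LIMSEQ_power_zero tendsto_const) (use l in auto)
  then obtain k0 where k0: "\<And>k. k \<ge> k0 \<Longrightarrow> cmod l ^ k * cmod (z T) < e / 2"
    using LIMSEQ_D[of _ 0 "e / 2"] \<open>e > 0\<close> by fastforce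
  have "norm (z t - 0) < e" if "t \<ge> T + k0" for t
  proof -
    from that have "T + (t - T) = t" "k0 \<le> t - T" by auto
    then show ?thesis
      using bound[of "t - T"] k0[of "t - T"] by simp
  qed
  then show "\<exists>no. \<forall>n\<ge>no. norm (z n - 0) < e"
    by blast
qed

text \<open>
  This reduces a recursion with the matrix \<^term>\<open>F\<close> on the left to the scalar
  multiples \<^term>\<open>mat l\<close> for eigenvalues \<^term>\<open>l\<close> of \<^term>\<open>F\<close>. Take a list with vanishing
  shift product and let \<open>Y = (F - l) X\<close> for its head \<open>l\<close>. As \<open>F - l\<close> commutes with \<open>F\<close>, the
  sequence \<open>Y\<close> solves a recursion of the same kind and is killed by a shorter list, hence tends
  to zero by induction. If \<open>l\<close> is an eigenvalue, then \<open>X\<close> solves the recursion with \<open>l\<close> in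
  place of \<open>F\<close>, perturbed by the null sequence \<open>Y R + D\<close>. If not, then \<open>F - l\<close> has a left
  inverse, which recovers \<open>X\<close> from \<open>Y\<close>. The roots in the list need not be eigenvalues, which
  is why the second case occurs.
\<close>

lemma left_factor_recursion_null:
  fixes F :: "complex^'n^'n" and R :: "complex^'k^'k" and X D :: "nat \<Rightarrow> complex^'k^'n"
  assumes eig: "\<And>l Y D'. \<exists>u. u \<noteq> 0 \<and> F *v u = l *s u \<Longrightarrow> D' \<longlonglongrightarrow> 0 \<Longrightarrow>
      (\<And>t. Y (Suc t) = mat l ** Y t ** R + D' t) \<Longrightarrow> Y \<longlonglongrightarrow> (0 :: complex^'k^'n)"
    and "\<And>t. X (Suc t) = F ** X t ** R + D t" and "D \<longlonglongrightarrow> 0"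
  shows "X \<longlonglongrightarrow> 0"
proof -
  have *: "X \<longlonglongrightarrow> 0"
    if "\<And>t. X (Suc t) = F ** X t ** R + D t" and "D \<longlonglongrightarrow> 0"
      and "\<And>t. shift_product F ls (X t) = 0" for ls and X D :: "nat \<Rightarrow> complex^'k^'n"
    using that
  proof (induction ls arbitrary: X D)
    case Nil
    then show ?case by simp
  next
    case (Cons l ls)
    let ?Y = "\<lambda>t. (F - mat l) ** X t"
    have Y: "?Y \<longlonglongrightarrow> 0"
    proof (rule Cons.IH)
      have "(F - mat l) ** F = F ** (F - mat l)"
        by (simp add: matrix_diff_rdistrib matrix_diff_ldistrib mat_commute)
      then show "?Y (Suc t) = F ** ?Y t ** R + (F - mat l) ** D t" for t
        by (simp add: Cons.prems(1) matrix_add_ldistrib matrix_mul_assoc)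
      show "(\<lambda>t. (F - mat l) ** D t) \<longlonglongrightarrow> 0"
        using tendsto_matrix_mult[OF tendsto_const Cons.prems(2)] by fastforce
      show "shift_product F ls (?Y t) = 0" for t
        using Cons.prems(3)[of t] by simp
    qed
    show ?case
    proof (cases "\<exists>u. u \<noteq> 0 \<and> F *v u = l *s u")
      case True
      show ?thesis
      proof (rule eig[OF True])
        show "X (Suc t) = mat l ** X t ** R + (?Y t ** R + D t)" for t
          by (simp add: Cons.prems(1) matrix_diff_rdistrib)
        show "(\<lambda>t. ?Y t ** R + D t) \<longlonglongrightarrow> 0"
          using tendsto_add[OF tendsto_matrix_mult[OF Y tendsto_const] Cons.prems(2)] by simp
      qed
    next
      case False
      have "mat l *v u = l *s u" for u :: "complex^'n"
      proof -
        have "(\<Sum>k\<in>UNIV. (if i = k then l else 0) * u $ k) = l * u $ i" for i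
          by (subst sum.remove[of _ i]) (auto intro!: sum.neutral)
        then show ?thesis
          by (simp add: vec_eq_iff matrix_vector_mult_def mat_def)
      qed
      then have "\<forall>u. (F - mat l) *v u = 0 \<longrightarrow> u = 0"
        using False by (auto simp: matrix_vector_mult_diff_rdistrib)
      then obtain B where B: "B ** (F - mat l) = mat 1"
        using matrix_left_invertible_ker by blast
      have "(\<lambda>t. B ** ?Y t) \<longlonglongrightarrow> B ** 0"
        by (intro tendsto_matrix_mult tendsto_const Y)
      then show ?thesis
        by (simp add: matrix_mul_assoc B)
    qed
  qed
  obtain ls where "\<And>X::complex^'k^'n. shift_product F ls X = 0"
    using annihilating_shift_product by blast
  then show ?thesis
    using *[OF assms(2,3)] by blast
qed

text \<open>
  The left factor is replaced by an eigenvalue \<open>l\<close> of \<^term>\<open>F\<close>; after transposition the same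
  reduction replaces \<^term>\<open>G\<close> by an eigenvalue \<open>m\<close>. What remains is, entry by entry, a scalar
  recursion with factor \<open>m l\<close> of modulus less than one.
\<close>

lemma complex_matrix_recursion_null:
  fixes F :: "complex^'n^'n" and G :: "complex^'k^'k" and X D :: "nat \<Rightarrow> complex^'k^'n"
  assumes F: "\<And>l u. u \<noteq> 0 \<Longrightarrow> F *v u = l *s u \<Longrightarrow> cmod l < 1"
    and G: "\<And>l u. u \<noteq> 0 \<Longrightarrow> G *v u = l *s u \<Longrightarrow> cmod l < 1"
    and X: "\<And>t. X (Suc t) = F ** X t ** transpose G + D t" and D: "D \<longlonglongrightarrow> 0"
  shows "X \<longlonglongrightarrow> 0"
proof (rule left_factor_recursion_null[OF _ X D])
  fix l and Y D' :: "nat \<Rightarrow> complex^'k^'n"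
  assume "\<exists>u. u \<noteq> 0 \<and> F *v u = l *s u" and D': "D' \<longlonglongrightarrow> 0"
    and Y: "\<And>t. Y (Suc t) = mat l ** Y t ** transpose G + D' t"
  then have l: "cmod l < 1"
    using F by blast
  have "(\<lambda>t. transpose (Y t)) \<longlonglongrightarrow> 0"
  proof (rule left_factor_recursion_null)
    show "transpose (Y (Suc t)) = G ** transpose (Y t) ** mat l + transpose (D' t)" for t
      by (simp add: Y transpose_add matrix_transpose_mul matrix_mul_assoc)
    show "(\<lambda>t. transpose (D' t)) \<longlonglongrightarrow> 0"
      using tendsto_transpose[OF D'] by simp
  next
    fix m and Z D'' :: "nat \<Rightarrow> complex^'n^'k"
    assume "\<exists>u. u \<noteq> 0 \<and> G *v u = m *s u" and D'': "D'' \<longlonglongrightarrow> 0"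
      and Z: "\<And>t. Z (Suc t) = mat m ** Z t ** mat l + D'' t"
    then have m: "cmod m < 1"
      using G by blast
    have "cmod (m * l) < 1"
      using mult_strict_mono[OF m l] by (simp add: norm_mult)
    moreover have "Z (Suc t) $ i $ j = (m * l) * Z t $ i $ j + D'' t $ i $ j" for t i j
      by (simp add: Z mat_mult_component)
    moreover have "(\<lambda>t. D'' t $ i $ j) \<longlonglongrightarrow> 0" for i j
      using tendsto_vec_nth[OF tendsto_vec_nth[OF D'']] by simp
    ultimately have "(\<lambda>t. Z t $ i $ j) \<longlonglongrightarrow> 0" for i j
      by (rule scalar_recursion_null[rotated 2])
    then show "Z \<longlonglongrightarrow> 0"
      by (auto intro!: vec_tendstoI)
  qed
  from tendsto_transpose[OF this] show "Y \<longlonglongrightarrow> 0"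
    by simp
qed

lemma map_matrix_of_real_mult:
  "map_matrix complex_of_real (A ** B) = map_matrix complex_of_real A ** map_matrix complex_of_real B"
  by (simp add: matrix_matrix_mult_def vec_eq_iff)

lemma map_matrix_of_real_add:
  "map_matrix complex_of_real (A + B) = map_matrix complex_of_real A + map_matrix complex_of_real B"
  by (simp add: vec_eq_iff)

lemma map_matrix_transpose: "map_matrix f (transpose A) = transpose (map_matrix f A)"
  by (simp add: vec_eq_iff transpose_def)

lemma map_matrix_of_real_tendsto_0_iff:
  fixes X :: "nat \<Rightarrow> real^'k^'n"
  shows "(\<lambda>t. map_matrix complex_of_real (X t)) \<longlonglongrightarrow> 0 \<longleftrightarrow> X \<longlonglongrightarrow> 0"
proof
  assume "(\<lambda>t. map_matrix complex_of_real (X t)) \<longlonglongrightarrow> 0"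
  from tendsto_vec_nth[OF tendsto_vec_nth[OF this]]
  have "(\<lambda>t. complex_of_real (X t $ i $ j)) \<longlonglongrightarrow> of_real 0" for i j
    by simp
  then have "(\<lambda>t. X t $ i $ j) \<longlonglongrightarrow> 0" for i j
    unfolding tendsto_of_real_iff .
  then show "X \<longlonglongrightarrow> 0"
    by (auto intro!: vec_tendstoI)
next
  assume "X \<longlonglongrightarrow> 0"
  from tendsto_vec_nth[OF tendsto_vec_nth[OF this]]
  have "(\<lambda>t. complex_of_real (X t $ i $ j)) \<longlonglongrightarrow> of_real 0" for i j
    by (intro tendsto_of_real) simp
  then show "(\<lambda>t. map_matrix complex_of_real (X t)) \<longlonglongrightarrow> 0"
    by (auto intro!: vec_tendstoI)
qed

text \<open>
  Schur stability is a condition on complex eigenvalues, so the real sequence is embedded into the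
  complex matrices. The perturbation is an arbitrary null sequence because the forcing terms
  of the covariance recursions are themselves known only through their limits.
\<close>

lemma schur_stable_recursion_null:
  fixes F :: "real^'n^'n" and G :: "real^'k^'k" and X D :: "nat \<Rightarrow> real^'k^'n"
  assumes "schur_stable F" "schur_stable G"
    and X: "\<And>t. X (Suc t) = F ** X t ** transpose G + D t" and D: "D \<longlonglongrightarrow> 0"
  shows "X \<longlonglongrightarrow> 0"
proof -
  have "(\<lambda>t. map_matrix complex_of_real (X t)) \<longlonglongrightarrow> 0"
  proof (rule complex_matrix_recursion_null)
    show "cmod l < 1" if "u \<noteq> 0" "map_matrix complex_of_real F *v u = l *s u" for l u
      using that assms(1) by (auto simp: schur_stable_def eigenvalue_def)
    show "cmod l < 1" if "u \<noteq> 0" "map_matrix complex_of_real G *v u = l *s u" for l u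
      using that assms(2) by (auto simp: schur_stable_def eigenvalue_def)
    show "map_matrix complex_of_real (X (Suc t)) =
        map_matrix complex_of_real F ** map_matrix complex_of_real (X t) **
        transpose (map_matrix complex_of_real G) + map_matrix complex_of_real (D t)" for t
      by (simp add: X map_matrix_of_real_add map_matrix_of_real_mult map_matrix_transpose)
    show "(\<lambda>t. map_matrix complex_of_real (D t)) \<longlonglongrightarrow> 0"
      using D by (simp add: map_matrix_of_real_tendsto_0_iff)
  qed
  then show ?thesis
    by (simp add: map_matrix_of_real_tendsto_0_iff)
qed

section \<open>The discrete-time Lyapunov equation\<close>

text \<open>
  The difference to a solution obeys the recursion without the constant term.
\<close>

lemma lyapunov_solution_limit:
  fixes F :: "real^'n^'n"
  assumes F: "schur_stable F" and S: "S = F ** S ** transpose F + R"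
    and X: "\<And>t. X (Suc t) = F ** X t ** transpose F + R + D t" and D: "D \<longlonglongrightarrow> 0"
  shows "X \<longlonglongrightarrow> S"
proof -
  have "(\<lambda>t. X t - S) \<longlonglongrightarrow> 0"
  proof (rule schur_stable_recursion_null[OF F F])
    show "X (Suc t) - S = F ** (X t - S) ** transpose F + D t" for t
      by (subst (1) S) (simp add: X matrix_diff_ldistrib matrix_diff_rdistrib)
  qed (rule D)
  then show ?thesis
    by (simp add: LIM_zero_iff)
qed

text \<open>
  A solution is a constant sequence that obeys the recursion, so it is its own limit.
\<close>

lemma lyapunov_unique:
  fixes F :: "real^'n^'n"
  assumes "schur_stable F" "S = F ** S ** transpose F + R" "S' = F ** S' ** transpose F + R"
  shows "S' = S"
proof -
  have "(\<lambda>t::nat. S') \<longlonglongrightarrow> S"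
    by (rule lyapunov_solution_limit[OF assms(1,2), where D = "\<lambda>_. 0"])
      (simp_all flip: assms(3))
  then show ?thesis
    using LIMSEQ_unique tendsto_const by blast
qed

text \<open>
  Uniqueness makes the linear map \<open>X \<mapsto> X - F X F\<^sup>T\<close> injective, and on a finite-dimensional space
  this implies surjectivity.
\<close>

lemma lyapunov_exists:
  fixes F R :: "real^'n^'n"
  assumes "schur_stable F"
  shows "\<exists>S. S = F ** S ** transpose F + R"
proof -
  let ?T = "\<lambda>X. X - F ** X ** transpose F"
  have lin: "linear ?T"
    by (rule linearI) (simp_all add: matrix_add_ldistrib matrix_add_rdistrib scalar_matrix_assoc
        matrix_scalar_ac scaleR_diff_right)
  have "X = 0" if "?T X = 0" for X
  proof (rule lyapunov_unique[OF assms])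
    show "X = F ** X ** transpose F + 0"
      using that by (simp only: right_minus_eq add_0_right)
  qed simp
  then have "inj ?T"
    using linear_injective_0[OF lin] by blast
  then have "surj ?T"
    by (intro linear_injective_imp_surjective[OF lin] refl)
  then have "R \<in> range ?T"
    by simp
  then obtain S where R: "R = ?T S"
    by (rule rangeE)
  show ?thesis
    unfolding R by (intro exI[of _ S]) simp
qed

lemma quadratic_form_congruence:
  fixes F :: "real^'n^'m"
  shows "x \<bullet> ((F ** X ** transpose F) *v x) = (transpose F *v x) \<bullet> (X *v (transpose F *v x))"
  by (metis dot_lmul_matrix matrix_vector_mul_assoc transpose_matrix_vector)

lemma pos_semidef_congruence:
  "pos_semidef X \<Longrightarrow> pos_semidef (F ** X ** transpose F)"
  unfolding pos_semidef_def quadratic_form_congruence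
  by (simp add: matrix_transpose_mul matrix_mul_assoc del: transpose_matrix_vector)

lemma pos_semidef_add: "pos_semidef X \<Longrightarrow> pos_semidef Y \<Longrightarrow> pos_semidef (X + Y)"
  by (simp add: pos_semidef_def transpose_add matrix_vector_mult_add_rdistrib inner_add_right)

lemma pos_def_imp_pos_semidef: "pos_def X \<Longrightarrow> pos_semidef X"
  unfolding pos_def_def pos_semidef_def by (metis inner_zero_left less_imp_le order_refl)

lemma pos_semidef_add_pos_def: "pos_semidef X \<Longrightarrow> pos_def Y \<Longrightarrow> pos_def (X + Y)"
  by (simp add: pos_semidef_def pos_def_def transpose_add matrix_vector_mult_add_rdistrib
      inner_add_right add_nonneg_pos)

lemma pos_semidef_limit:
  fixes X :: "nat \<Rightarrow> real^'n^'n"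
  assumes lim: "X \<longlonglongrightarrow> S" and psd: "\<And>t. pos_semidef (X t)"
  shows "pos_semidef S"
  unfolding pos_semidef_def
proof (intro conjI allI)
  have "X \<longlonglongrightarrow> transpose S"
    using tendsto_transpose[OF lim] psd by (simp add: pos_semidef_def)
  then show "transpose S = S"
    using lim LIMSEQ_unique by blast
  fix x
  have "(\<lambda>t. x \<bullet> (X t *v x)) \<longlonglongrightarrow> x \<bullet> (S *v x)"
    unfolding matrix_vector_mult_def
    by (intro tendsto_inner tendsto_const vec_tendstoI)
      (auto intro!: tendsto_sum tendsto_mult tendsto_vec_nth[OF tendsto_vec_nth[OF lim]])
  then show "0 \<le> x \<bullet> (S *v x)"
    by (rule LIMSEQ_le_const) (use psd in \<open>auto simp: pos_semidef_def\<close>)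
qed

text \<open>
  The solution is the limit of the iteration started at zero, all of whose terms are positive
  semidefinite.
\<close>

lemma lyapunov_pos_semidef:
  fixes F R :: "real^'n^'n"
  assumes "schur_stable F" "S = F ** S ** transpose F + R" "pos_semidef R"
  shows "pos_semidef S"
proof -
  define X where "X t = ((\<lambda>X. F ** X ** transpose F + R) ^^ t) 0" for t
  have "X \<longlonglongrightarrow> S"
    by (rule lyapunov_solution_limit[where D = "\<lambda>_. 0", OF assms(1,2)]) (auto simp: X_def)
  moreover have "pos_semidef (X t)" for t
    by (induction t)
      (auto simp: X_def assms(3) intro!: pos_semidef_add pos_semidef_congruence, simp add: pos_semidef_def)
  ultimately show ?thesis
    by (rule pos_semidef_limit)
qed

section \<open>Covariances of square-integrable random vectors\<close>

definition square_integrable :: "'a measure \<Rightarrow> ('a \<Rightarrow> 'b::euclidean_space) \<Rightarrow> bool" where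
  "square_integrable M X \<longleftrightarrow> X \<in> borel_measurable M \<and> integrable M (\<lambda>\<omega>. (norm (X \<omega>))\<^sup>2)"

definition cross_covariance ::
  "'a measure \<Rightarrow> ('a \<Rightarrow> real^'n) \<Rightarrow> ('a \<Rightarrow> real^'k) \<Rightarrow> real^'k^'n" where
  "cross_covariance M X Y =
     integral\<^sup>L M (\<lambda>\<omega>. outer_prod (X \<omega> - integral\<^sup>L M X) (Y \<omega> - integral\<^sup>L M Y))"

lemma covariance_eq_cross: "covariance M X = cross_covariance M X X"
  by (simp add: covariance_def cross_covariance_def)

lemma outer_prod_mult_left: "outer_prod (A *v x) y = A ** outer_prod x y"
  by (simp add: outer_prod_def matrix_vector_mult_def matrix_matrix_mult_def vec_eq_iff
      sum_distrib_right mult.assoc)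

lemma outer_prod_commute: "outer_prod y x = transpose (outer_prod x y)"
  by (simp add: outer_prod_def transpose_def vec_eq_iff mult.commute)

lemma bounded_bilinear_outer_prod: "bounded_bilinear (outer_prod :: real^'n \<Rightarrow> real^'k \<Rightarrow> _)"
  unfolding bilinear_conv_bounded_bilinear[symmetric] bilinear_def
  by (auto intro!: linearI simp: outer_prod_def vec_eq_iff algebra_simps)

lemma outer_prod_zero: "outer_prod (0::real^'n) (y::real^'k) = 0" "outer_prod (x::real^'n) (0::real^'k) = 0"
  by (simp_all add: outer_prod_def vec_eq_iff)

lemma bounded_linear_matrix_mult_left: "bounded_linear (\<lambda>X::real^'k^'n. (A::real^'n^'m) ** X)"
  by (auto intro!: linearI simp: linear_conv_bounded_linear[symmetric] matrix_add_ldistrib matrix_scalar_ac scalar_matrix_assoc)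

lemma bounded_linear_transpose: "bounded_linear (transpose :: real^'k^'n \<Rightarrow> _)"
  by (auto intro!: linearI simp: linear_conv_bounded_linear[symmetric] transpose_add transpose_scalar)

lemma square_integrable_cong:
  assumes "\<And>\<omega>. \<omega> \<in> space M \<Longrightarrow> X \<omega> = Y \<omega>"
  shows "square_integrable M X \<longleftrightarrow> square_integrable M Y"
  unfolding square_integrable_def
  using assms by (intro conj_cong measurable_cong Bochner_Integration.integrable_cong) auto

lemma cross_covariance_cong:
  assumes "\<And>\<omega>. \<omega> \<in> space M \<Longrightarrow> X \<omega> = X' \<omega>" "\<And>\<omega>. \<omega> \<in> space M \<Longrightarrow> Y \<omega> = Y' \<omega>"
  shows "cross_covariance M X Y = cross_covariance M X' Y'"
proof -
  have "integral\<^sup>L M X = integral\<^sup>L M X'" "integral\<^sup>L M Y = integral\<^sup>L M Y'"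
    using assms by (auto intro!: Bochner_Integration.integral_cong)
  then show ?thesis
    unfolding cross_covariance_def
    using assms by (auto intro!: Bochner_Integration.integral_cong)
qed

lemma square_integrable_add [simp, intro]:
  assumes "square_integrable M X" "square_integrable M Y"
  shows "square_integrable M (\<lambda>\<omega>. X \<omega> + Y \<omega>)"
proof -
  have [measurable]: "X \<in> borel_measurable M" "Y \<in> borel_measurable M"
    using assms by (auto simp: square_integrable_def)
  have bound: "(norm (a + b))\<^sup>2 \<le> 2 * (norm a)\<^sup>2 + 2 * (norm b)\<^sup>2" for a b :: 'b
  proof -
    have "(norm (a + b))\<^sup>2 \<le> (norm a + norm b)\<^sup>2"
      by (intro power_mono norm_triangle_ineq norm_ge_zero)
    also have "\<dots> \<le> 2 * (norm a)\<^sup>2 + 2 * (norm b)\<^sup>2"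
      using sum_squares_bound[of "norm a" "norm b"] by (simp add: power2_sum)
    finally show ?thesis .
  qed
  have "integrable M (\<lambda>\<omega>. (norm (X \<omega> + Y \<omega>))\<^sup>2)"
  proof (rule Bochner_Integration.integrable_bound)
    show "integrable M (\<lambda>\<omega>. 2 * (norm (X \<omega>))\<^sup>2 + 2 * (norm (Y \<omega>))\<^sup>2)"
      using assms by (simp add: square_integrable_def)
    show "AE \<omega> in M. norm ((norm (X \<omega> + Y \<omega>))\<^sup>2) \<le>
        norm (2 * (norm (X \<omega>))\<^sup>2 + 2 * (norm (Y \<omega>))\<^sup>2)"
      using bound by (intro always_eventually allI) simp
  qed measurable
  then show ?thesis
    by (simp add: square_integrable_def)
qed

lemma square_integrable_bounded_linear:
  assumes "square_integrable M X" and f: "bounded_linear f"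
  shows "square_integrable M (\<lambda>\<omega>. f (X \<omega>))"
proof -
  have X [measurable]: "X \<in> borel_measurable M"
    using assms by (auto simp: square_integrable_def)
  have [measurable]: "(\<lambda>\<omega>. f (X \<omega>)) \<in> borel_measurable M"
    using X borel_measurable_continuous_onI[OF linear_continuous_on[OF f]]
    by (rule measurable_compose)
  have "integrable M (\<lambda>\<omega>. (norm (f (X \<omega>)))\<^sup>2)"
  proof (rule Bochner_Integration.integrable_bound)
    show "integrable M (\<lambda>\<omega>. (onorm f)\<^sup>2 * (norm (X \<omega>))\<^sup>2)"
      using assms(1) by (simp add: square_integrable_def)
    have "(norm (f x))\<^sup>2 \<le> (onorm f)\<^sup>2 * (norm x)\<^sup>2" for x
      using power_mono[OF onorm[OF f, of x] norm_ge_zero, of 2] by (simp add: power_mult_distrib)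
    then show "AE \<omega> in M. norm ((norm (f (X \<omega>)))\<^sup>2) \<le> norm ((onorm f)\<^sup>2 * (norm (X \<omega>))\<^sup>2)"
      by simp
  qed measurable
  then show ?thesis
    by (simp add: square_integrable_def)
qed

lemma square_integrable_matrix [simp, intro]:
  fixes A :: "real^'n^'m"
  shows "square_integrable M X \<Longrightarrow> square_integrable M (\<lambda>\<omega>. A *v X \<omega>)"
  by (rule square_integrable_bounded_linear[OF _ matrix_vector_mul_bounded_linear])

text \<open>
  Square integrability makes the mixed second moments finite, through
  \<open>2 ab \<le> a\<^sup>2 + b\<^sup>2\<close> applied to the two norms.
\<close>

lemma integrable_outer_prod:
  assumes X: "square_integrable M X" and Y: "square_integrable M Y"
  shows "integrable M (\<lambda>\<omega>. outer_prod (X \<omega>) (Y \<omega>))"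
proof -
  obtain K where K: "0 < K" "\<And>(x::real^'b) (y::real^'c). norm (outer_prod x y) \<le> norm x * norm y * K"
    using bounded_bilinear.pos_bounded[OF bounded_bilinear_outer_prod] by blast
  have bound: "norm (outer_prod x y) \<le> K * ((norm x)\<^sup>2 + (norm y)\<^sup>2)" for x :: "real^'b" and y :: "real^'c"
  proof -
    have "0 \<le> norm x * norm y" by simp
    then have "norm x * norm y \<le> (norm x)\<^sup>2 + (norm y)\<^sup>2"
      using sum_squares_bound[of "norm x" "norm y"] unfolding mult.assoc by linarith
    from mult_left_mono[OF this less_imp_le[OF K(1)]] show ?thesis
      using K(2)[of x y] by (simp only: mult.commute[of _ K])
  qed
  have m: "(\<lambda>\<omega>. outer_prod (X \<omega>) (Y \<omega>)) \<in> borel_measurable M"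
    by (rule borel_measurable_continuous_Pair)
      (use X Y in \<open>simp_all add: square_integrable_def
        bounded_bilinear.continuous_on[OF bounded_bilinear_outer_prod
          continuous_on_fst[OF continuous_on_id] continuous_on_snd[OF continuous_on_id]]\<close>)
  have i: "integrable M (\<lambda>\<omega>. K * ((norm (X \<omega>))\<^sup>2 + (norm (Y \<omega>))\<^sup>2))"
    using X Y by (simp add: square_integrable_def)
  have "AE \<omega> in M. norm (outer_prod (X \<omega>) (Y \<omega>)) \<le> norm (K * ((norm (X \<omega>))\<^sup>2 + (norm (Y \<omega>))\<^sup>2))"
    using bound K(1) by (intro always_eventually) (simp add: abs_mult)
  then show ?thesis
    by (rule Bochner_Integration.integrable_bound[OF i m])
qed

context prob_space
begin

lemma square_integrable_const [simp, intro]: "square_integrable M (\<lambda>\<omega>. c)"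
  by (simp add: square_integrable_def)

lemma square_integrable_imp_integrable:
  assumes "square_integrable M X"
  shows "integrable M X"
proof (rule Bochner_Integration.integrable_bound)
  show "integrable M (\<lambda>\<omega>. 1 + (norm (X \<omega>))\<^sup>2)"
    using assms by (simp add: square_integrable_def)
  have "norm x \<le> norm (1 + (norm x)\<^sup>2)" for x :: 'b
    using sum_squares_bound[of 1 "norm x"] norm_ge_zero[of x] by (simp del: norm_ge_zero)
  then show "AE \<omega> in M. norm (X \<omega>) \<le> norm (1 + (norm (X \<omega>))\<^sup>2)"
    by simp
qed (use assms in \<open>simp add: square_integrable_def\<close>)

lemma integrable_outer_prod_centred:
  assumes "square_integrable M X" "square_integrable M Y"
  shows "integrable M (\<lambda>\<omega>. outer_prod (X \<omega> - integral\<^sup>L M X) (Y \<omega> - integral\<^sup>L M Y))"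
proof (rule integrable_outer_prod)
  show "square_integrable M (\<lambda>\<omega>. X \<omega> - integral\<^sup>L M X)"
    unfolding diff_conv_add_uminus by (rule square_integrable_add[OF assms(1) square_integrable_const])
  show "square_integrable M (\<lambda>\<omega>. Y \<omega> - integral\<^sup>L M Y)"
    unfolding diff_conv_add_uminus by (rule square_integrable_add[OF assms(2) square_integrable_const])
qed

lemma cross_covariance_commute:
  assumes "square_integrable M X" "square_integrable M Y"
  shows "cross_covariance M Y X = transpose (cross_covariance M X Y)"
proof -
  have eq: "outer_prod (Y \<omega> - integral\<^sup>L M Y) (X \<omega> - integral\<^sup>L M X) =
      transpose (outer_prod (X \<omega> - integral\<^sup>L M X) (Y \<omega> - integral\<^sup>L M Y))" for \<omega>
    by (rule outer_prod_commute)
  show ?thesis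
    unfolding cross_covariance_def eq
    by (rule integral_bounded_linear[OF bounded_linear_transpose integrable_outer_prod_centred[OF assms]])
qed

lemma cross_covariance_const_left [simp]: "cross_covariance M (\<lambda>\<omega>. c) Y = 0"
  by (simp add: cross_covariance_def prob_space outer_prod_zero)

lemma cross_covariance_add_left:
  assumes "square_integrable M X" "square_integrable M X'" "square_integrable M Y"
  shows "cross_covariance M (\<lambda>\<omega>. X \<omega> + X' \<omega>) Y = cross_covariance M X Y + cross_covariance M X' Y"
proof -
  have "outer_prod (X \<omega> + X' \<omega> - integral\<^sup>L M (\<lambda>\<omega>. X \<omega> + X' \<omega>)) y =
      outer_prod (X \<omega> - integral\<^sup>L M X) y + outer_prod (X' \<omega> - integral\<^sup>L M X') y" for \<omega> and y :: "real^'c"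
    using assms by (simp add: square_integrable_imp_integrable outer_prod_def vec_eq_iff algebra_simps)
  then show ?thesis
    using assms by (simp add: cross_covariance_def integrable_outer_prod_centred)
qed

lemma cross_covariance_matrix_left:
  assumes "square_integrable M X" "square_integrable M Y"
  shows "cross_covariance M (\<lambda>\<omega>. A *v X \<omega>) Y = A ** cross_covariance M X Y"
proof -
  have "integral\<^sup>L M (\<lambda>\<omega>. A *v X \<omega>) = A *v integral\<^sup>L M X"
    by (rule integral_bounded_linear[OF matrix_vector_mul_bounded_linear
          square_integrable_imp_integrable[OF assms(1)]])
  then have "cross_covariance M (\<lambda>\<omega>. A *v X \<omega>) Y =
      integral\<^sup>L M (\<lambda>\<omega>. A ** outer_prod (X \<omega> - integral\<^sup>L M X) (Y \<omega> - integral\<^sup>L M Y))"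
    by (simp add: cross_covariance_def outer_prod_mult_left flip: matrix_vector_mult_diff_distrib)
  also have "\<dots> = A ** cross_covariance M X Y"
    unfolding cross_covariance_def
    by (rule integral_bounded_linear[OF bounded_linear_matrix_mult_left integrable_outer_prod_centred[OF assms]])
  finally show ?thesis .
qed

lemma cross_covariance_add_right:
  assumes "square_integrable M X" "square_integrable M X'" "square_integrable M Y"
  shows "cross_covariance M Y (\<lambda>\<omega>. X \<omega> + X' \<omega>) = cross_covariance M Y X + cross_covariance M Y X'"
  using assms
  by (simp add: cross_covariance_commute[of _ Y] cross_covariance_add_left transpose_add)

lemma cross_covariance_matrix_right:
  assumes "square_integrable M X" "square_integrable M Y"
  shows "cross_covariance M Y (\<lambda>\<omega>. A *v X \<omega>) = cross_covariance M Y X ** transpose A"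
  using assms
  by (simp add: cross_covariance_commute[of _ Y] cross_covariance_matrix_left matrix_transpose_mul)

lemmas cross_covariance_bilinear =
  cross_covariance_add_left cross_covariance_add_right
  cross_covariance_matrix_left cross_covariance_matrix_right

end

section \<open>Covariance recursions of estimate and error\<close>

text \<open>
  The closed loop in the coordinates estimation error and estimate: with error \<open>e = x - xh\<close>, the
  matrices are \<open>F = A + B K\<close>, \<open>G = A - L C\<close> and \<open>H = L C\<close>. In these coordinates the system is
  block triangular, since the error does not depend on the estimate. The dynamics are required only
  on the space of the measure, as in the closed loop itself.
\<close>

locale estimation_loop = prob_space M for M :: "'a measure" +
  fixes F G H :: "real^'n^'n" and L :: "real^'p^'n"
    and W :: "real^'n^'n" and V :: "real^'p^'p"
    and w :: "nat \<Rightarrow> 'a \<Rightarrow> real^'n" and v :: "nat \<Rightarrow> 'a \<Rightarrow> real^'p"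
    and e xh :: "nat \<Rightarrow> 'a \<Rightarrow> real^'n" and e0 xh0 :: "real^'n"
  assumes w_noise: "wss_noise M w W" and v_noise: "wss_noise M v V"
    and uncorrelated: "uncorrelated_processes M w v"
    and e_0: "\<omega> \<in> space M \<Longrightarrow> e 0 \<omega> = e0"
    and xh_0: "\<omega> \<in> space M \<Longrightarrow> xh 0 \<omega> = xh0"
    and e_Suc: "\<omega> \<in> space M \<Longrightarrow> e (Suc t) \<omega> = G *v e t \<omega> + (w t \<omega> + (- L) *v v t \<omega>)"
    and xh_Suc: "\<omega> \<in> space M \<Longrightarrow> xh (Suc t) \<omega> = F *v xh t \<omega> + (H *v e t \<omega> + L *v v t \<omega>)"
begin

lemma noise_square_integrable [simp, intro]: "square_integrable M (w t)" "square_integrable M (v t)"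
  using w_noise v_noise by (auto simp: wss_noise_def square_integrable_def)

lemma noise_covariance:
  "cross_covariance M (w s) (w t) = (if s = t then W else 0)"
  "cross_covariance M (v s) (v t) = (if s = t then V else 0)"
  "cross_covariance M (w s) (v t) = 0"
  "cross_covariance M (v t) (w s) = 0"
proof -
  show "cross_covariance M (w s) (w t) = (if s = t then W else 0)"
    "cross_covariance M (v s) (v t) = (if s = t then V else 0)"
    using w_noise v_noise by (auto simp: wss_noise_def cross_covariance_def)
  show wv: "cross_covariance M (w s) (v t) = 0"
    using uncorrelated by (simp add: uncorrelated_processes_def cross_covariance_def)
  show "cross_covariance M (v t) (w s) = 0"
    by (simp add: cross_covariance_commute[of "w s" "v t"] wv)
qed

lemma state_square_integrable [simp, intro]:
  "square_integrable M (e t)" "square_integrable M (xh t)"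
proof (induction t)
  case 0
  show "square_integrable M (e 0)" "square_integrable M (xh 0)"
    using square_integrable_cong[of M, OF e_0] square_integrable_cong[of M, OF xh_0] by simp_all
next
  case (Suc t)
  then show "square_integrable M (e (Suc t))" "square_integrable M (xh (Suc t))"
    using square_integrable_cong[of M, OF e_Suc[of _ t]] square_integrable_cong[of M, OF xh_Suc[of _ t]]
    by (simp_all add: square_integrable_add square_integrable_matrix)
qed

text \<open>
  Error and estimate at time \<^term>\<open>t\<close> are affine functions of the noise at times
  before \<^term>\<open>t\<close>, so they are uncorrelated with whatever that noise is uncorrelated with.
\<close>

lemma uncorrelated_with_later:
  assumes "square_integrable M N"
    and "\<And>s. s < t \<Longrightarrow> cross_covariance M (w s) N = 0"
    and "\<And>s. s < t \<Longrightarrow> cross_covariance M (v s) N = 0"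
  shows "cross_covariance M (e t) N = 0 \<and> cross_covariance M (xh t) N = 0"
  using assms
proof (induction t)
  case 0
  then show ?case
    using cross_covariance_cong[of M "e 0" "\<lambda>_. e0" N N] cross_covariance_cong[of M "xh 0" "\<lambda>_. xh0" N N]
    by (simp add: e_0 xh_0)
next
  case (Suc t)
  then show ?case
    using cross_covariance_cong[of M _ _ N N, OF e_Suc[of _ t]]
      cross_covariance_cong[of M _ _ N N, OF xh_Suc[of _ t]]
    by (simp add: cross_covariance_bilinear)
qed

lemma uncorrelated_with_current_noise [simp]:
  "cross_covariance M (e t) (w t) = 0" "cross_covariance M (xh t) (w t) = 0"
  "cross_covariance M (e t) (v t) = 0" "cross_covariance M (xh t) (v t) = 0"
  "cross_covariance M (w t) (e t) = 0" "cross_covariance M (w t) (xh t) = 0"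
  "cross_covariance M (v t) (e t) = 0" "cross_covariance M (v t) (xh t) = 0"
proof -
  show *: "cross_covariance M (e t) (w t) = 0" "cross_covariance M (xh t) (w t) = 0"
    "cross_covariance M (e t) (v t) = 0" "cross_covariance M (xh t) (v t) = 0"
    using uncorrelated_with_later[of "w t" t] uncorrelated_with_later[of "v t" t]
    by (simp_all add: noise_covariance)
  show "cross_covariance M (w t) (e t) = 0" "cross_covariance M (w t) (xh t) = 0"
    "cross_covariance M (v t) (e t) = 0" "cross_covariance M (v t) (xh t) = 0"
    by (simp_all add: * cross_covariance_commute[of "e t"] cross_covariance_commute[of "xh t"])
qed

lemma error_covariance_Suc:
  "cross_covariance M (e (Suc t)) (e (Suc t)) =
    G ** cross_covariance M (e t) (e t) ** transpose G + (W + L ** V ** transpose L)"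
  using cross_covariance_cong[of M, OF e_Suc[of _ t] e_Suc[of _ t]]
  by (simp add: cross_covariance_bilinear noise_covariance matrix_mul_assoc
      matrix_neg_left matrix_neg_right transpose_neg)

lemma error_estimate_covariance_Suc:
  "cross_covariance M (e (Suc t)) (xh (Suc t)) =
    G ** cross_covariance M (e t) (xh t) ** transpose F +
    (G ** cross_covariance M (e t) (e t) ** transpose H - L ** V ** transpose L)"
  using cross_covariance_cong[of M, OF e_Suc[of _ t] xh_Suc[of _ t]]
  by (simp add: cross_covariance_bilinear noise_covariance matrix_mul_assoc matrix_add_ldistrib
      matrix_neg_left)

text \<open>
  The covariance of the estimate obeys the Lyapunov recursion, driven by the two other covariances.
\<close>

lemma estimate_covariance_Suc:
  "cross_covariance M (xh (Suc t)) (xh (Suc t)) =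
    F ** cross_covariance M (xh t) (xh t) ** transpose F +
    (F ** transpose (cross_covariance M (e t) (xh t)) ** transpose H +
     H ** cross_covariance M (e t) (xh t) ** transpose F +
     H ** cross_covariance M (e t) (e t) ** transpose H + L ** V ** transpose L)"
  using cross_covariance_cong[of M, OF xh_Suc[of _ t] xh_Suc[of _ t]]
  by (simp add: cross_covariance_bilinear noise_covariance matrix_mul_assoc matrix_add_ldistrib
      cross_covariance_commute[of "e t" "xh t"] algebra_simps)

text \<open>
  The three covariances are handled in the order in which they drive each other. The error
  covariance converges to \<^term>\<open>E\<close> since \<^term>\<open>E\<close> solves its Lyapunov equation. The cross
  covariance is then driven by a term that tends to
  \<^term>\<open>G ** E ** transpose H - L ** V ** transpose L\<close>, which vanishes. Hence the recursion of
  the estimate covariance differs from its stationary version by a null sequence.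
\<close>

lemma covariance_limits:
  assumes "schur_stable F" "schur_stable G"
    and E: "E = G ** E ** transpose G + (W + L ** V ** transpose L)"
    and orth: "G ** E ** transpose H = L ** V ** transpose L"
    and S: "S = F ** S ** transpose F + (H ** E ** transpose H + L ** V ** transpose L)"
  shows "(\<lambda>t. covariance M (xh t)) \<longlonglongrightarrow> S"
    and "(\<lambda>t. covariance M (\<lambda>\<omega>. xh t \<omega> + e t \<omega>)) \<longlonglongrightarrow> S + E"
proof -
  let ?P = "\<lambda>t. cross_covariance M (e t) (e t)"
  let ?Q = "\<lambda>t. cross_covariance M (e t) (xh t)"
  let ?S = "\<lambda>t. cross_covariance M (xh t) (xh t)"
  have P: "?P \<longlonglongrightarrow> E"
    by (rule lyapunov_solution_limit[OF assms(2) E, where D = "\<lambda>_. 0"])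
      (simp_all add: error_covariance_Suc)
  have Q: "?Q \<longlonglongrightarrow> 0"
  proof (rule schur_stable_recursion_null[OF assms(2,1)])
    show "?Q (Suc t) = G ** ?Q t ** transpose F + (G ** ?P t ** transpose H - L ** V ** transpose L)" for t
      by (rule error_estimate_covariance_Suc)
    have "(\<lambda>t. G ** ?P t ** transpose H - L ** V ** transpose L) \<longlonglongrightarrow>
        G ** E ** transpose H - L ** V ** transpose L"
      by (intro tendsto_diff tendsto_matrix_mult tendsto_const P)
    then show "(\<lambda>t. G ** ?P t ** transpose H - L ** V ** transpose L) \<longlonglongrightarrow> 0"
      by (simp add: orth)
  qed
  have S_lim: "?S \<longlonglongrightarrow> S"
  proof (rule lyapunov_solution_limit[OF assms(1) S])
    let ?D = "\<lambda>t. F ** transpose (?Q t) ** transpose H + H ** ?Q t ** transpose F +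
        (H ** ?P t ** transpose H - H ** E ** transpose H)"
    show "?S (Suc t) = F ** ?S t ** transpose F + (H ** E ** transpose H + L ** V ** transpose L) + ?D t" for t
      by (simp add: estimate_covariance_Suc)
    have "?D \<longlonglongrightarrow> F ** transpose 0 ** transpose H + H ** 0 ** transpose F +
        (H ** E ** transpose H - H ** E ** transpose H)"
      by (intro tendsto_add tendsto_diff tendsto_matrix_mult tendsto_transpose tendsto_const P Q)
    then show "?D \<longlonglongrightarrow> 0"
      by simp
  qed
  then show "(\<lambda>t. covariance M (xh t)) \<longlonglongrightarrow> S"
    by (simp add: covariance_eq_cross)
  have "covariance M (\<lambda>\<omega>. xh t \<omega> + e t \<omega>) = ?S t + transpose (?Q t) + (?Q t + ?P t)" for t
    by (simp add: covariance_eq_cross cross_covariance_bilinear cross_covariance_commute[of "e t" "xh t"])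
  moreover have "(\<lambda>t. ?S t + transpose (?Q t) + (?Q t + ?P t)) \<longlonglongrightarrow> S + transpose 0 + (0 + E)"
    by (intro tendsto_add tendsto_transpose S_lim Q P)
  ultimately show "(\<lambda>t. covariance M (\<lambda>\<omega>. xh t \<omega> + e t \<omega>)) \<longlonglongrightarrow> S + E"
    by simp
qed

end

section \<open>The stationary Kalman gain\<close>

lemma matrix_inv_left_pos_def:
  fixes N :: "real^'n^'n"
  assumes "pos_def N"
  shows "matrix_inv N ** N = mat 1"
proof -
  have "\<forall>x. N *v x = 0 \<longrightarrow> x = 0"
    using assms unfolding pos_def_def by (metis inner_zero_right less_irrefl)
  then obtain B where "B ** N = mat 1"
    using matrix_left_invertible_ker by blast
  then have "\<exists>B. N ** B = mat 1 \<and> B ** N = mat 1"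
    using matrix_left_right_inverse by blast
  then have "N ** matrix_inv N = mat 1 \<and> matrix_inv N ** N = mat 1"
    unfolding matrix_inv_def by (rule someI_ex)
  then show ?thesis ..
qed

text \<open>
  Both identities follow from \<open>L N = A E C\<^sup>T\<close> with the innovation covariance
  \<open>N = C E C\<^sup>T + V\<close>, which is invertible because it is positive definite. The first is the
  Joseph form of the Riccati equation: it shows that \<^term>\<open>E\<close> is stationary for the error
  dynamics. The second says that estimate and error stay uncorrelated: the correlation created by
  the propagated error cancels against the one created by the measurement noise, and it is the
  optimality of the gain that makes the two equal.
\<close>

lemma kalman_gain_identities:
  fixes A W E :: "real^'n^'n" and C :: "real^'n^'p" and V :: "real^'p^'p"
  assumes V: "pos_def V" and E: "kalman_error_cov A C W V E" and L: "L = kalman_gain A C V E"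
  shows "E = (A - L ** C) ** E ** transpose (A - L ** C) + (W + L ** V ** transpose L)"
    and "(A - L ** C) ** E ** transpose (L ** C) = L ** V ** transpose L"
proof -
  define N where "N = C ** E ** transpose C + V"
  have Epd: "pos_def E"
    and Ric: "E = A ** E ** transpose A - L ** C ** E ** transpose A + W"
    using E by (auto simp: kalman_error_cov_def L kalman_gain_def)
  have "pos_def N"
    unfolding N_def
    by (intro pos_semidef_add_pos_def pos_semidef_congruence pos_def_imp_pos_semidef Epd V)
  then have LN: "L ** N = A ** E ** transpose C"
    unfolding L kalman_gain_def N_def[symmetric]
    by (simp add: matrix_inv_left_pos_def flip: matrix_mul_assoc)
  then have LNL: "L ** C ** E ** transpose C ** transpose L + L ** V ** transpose L =
      A ** E ** transpose C ** transpose L"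
    unfolding N_def by (metis matrix_add_ldistrib matrix_add_rdistrib matrix_mul_assoc)
  then show "(A - L ** C) ** E ** transpose (L ** C) = L ** V ** transpose L"
    by (simp add: matrix_diff_rdistrib matrix_transpose_mul matrix_mul_assoc algebra_simps)
  have "(A - L ** C) ** E ** transpose (A - L ** C) + (W + L ** V ** transpose L) =
      A ** E ** transpose A - L ** C ** E ** transpose A + W"
    using LNL
    by (simp add: matrix_diff_rdistrib matrix_diff_ldistrib transpose_diff matrix_transpose_mul
        matrix_mul_assoc algebra_simps)
  then show "E = (A - L ** C) ** E ** transpose (A - L ** C) + (W + L ** V ** transpose L)"
    using Ric by simp
qed

theorem lemma14:
  fixes A :: "real^'n^'n" and B :: "real^'m^'n" and C :: "real^'n^'p"
    and K :: "real^'n^'m" and L :: "real^'p^'n"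
    and W E :: "real^'n^'n" and V :: "real^'p^'p"
    and M :: "'a measure"
    and w :: "nat \<Rightarrow> 'a \<Rightarrow> real^'n" and v :: "nat \<Rightarrow> 'a \<Rightarrow> real^'p"
  assumes "prob_space M"
    and "stabilizable A B" and "observable A C"
    and "pos_def W" and "pos_def V"
    and "wss_noise M w W \<or> nrm_noise M w W"
    and "wss_noise M v V"
    and "uncorrelated_processes M w v"
    and "kalman_error_cov A C W V E"
    and "L = kalman_gain A C V E"
    and "strictly_stabilizing A B K"
  shows "\<exists>S X. pos_semidef S \<and> estimate_lyapunov A B C K L E V S \<and>
           (\<forall>S'. pos_semidef S' \<and> estimate_lyapunov A B C K L E V S' \<longrightarrow> S' = S) \<and>
           pos_def X \<and> X = S + E \<and>
           (\<forall>x0 xh0 x xh u y. kalman_closed_loop M A B C K L w v x0 xh0 x xh u y \<longrightarrow>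
              (\<lambda>t. covariance M (xh t)) \<longlonglongrightarrow> S \<and>
              (\<lambda>t. covariance M (x t)) \<longlonglongrightarrow> X)"
proof -
  define F G H where "F = A + B ** K" and "G = A - L ** C" and "H = L ** C"
  define R where "R = H ** E ** transpose H + L ** V ** transpose L"
  have stable: "schur_stable F" "schur_stable G"
    using assms(9-11) by (auto simp: F_def G_def strictly_stabilizing_def kalman_error_cov_def)
  have E: "pos_def E"
    using assms(9) by (simp add: kalman_error_cov_def)
  have lyap: "estimate_lyapunov A B C K L E V S \<longleftrightarrow> S = F ** S ** transpose F + R" for S
    by (simp add: estimate_lyapunov_def F_def H_def R_def add.assoc)
  have R: "pos_semidef R"
    unfolding R_def by (intro pos_semidef_add pos_semidef_congruence pos_def_imp_pos_semidef E assms)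
  obtain S where S: "S = F ** S ** transpose F + R"
    using lyapunov_exists[OF stable(1)] by blast
  have Spsd: "pos_semidef S"
    by (rule lyapunov_pos_semidef[OF stable(1) S R])
  have "(\<lambda>t. covariance M (xh t)) \<longlonglongrightarrow> S \<and> (\<lambda>t. covariance M (x t)) \<longlonglongrightarrow> S + E"
    if loop: "kalman_closed_loop M A B C K L w v x0 xh0 x xh u y" for x0 xh0 x xh u y
  proof -
    interpret estimation_loop M F G H L W V w v "\<lambda>t \<omega>. x t \<omega> - xh t \<omega>" xh "x0 - xh0" xh0
    proof (rule estimation_loop.intro[OF assms(1)], unfold_locales)
      show "wss_noise M w W"
        using assms(6) by (auto simp: nrm_noise_def)
      fix t \<omega> assume "\<omega> \<in> space M"
      then have "x 0 \<omega> = x0" "xh 0 \<omega> = xh0"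
        and step: "x (Suc t) \<omega> = A *v x t \<omega> + B *v (K *v xh t \<omega>) + w t \<omega>"
          "xh (Suc t) \<omega> = A *v xh t \<omega> + B *v (K *v xh t \<omega>) +
             L *v (C *v x t \<omega> + v t \<omega> - C *v xh t \<omega>)"
        using loop by (auto simp: kalman_closed_loop_def)
      then show "x 0 \<omega> - xh 0 \<omega> = x0 - xh0" "xh 0 \<omega> = xh0"
        by auto
      have neg: "(- L) *v b = - (L *v b)" for b
        by (simp add: matrix_vector_mult_def vec_eq_iff sum_negf)
      show "x (Suc t) \<omega> - xh (Suc t) \<omega> = G *v (x t \<omega> - xh t \<omega>) + (w t \<omega> + (- L) *v v t \<omega>)"
        by (simp add: step G_def neg algebra_simps flip: matrix_vector_mul_assoc)
      show "xh (Suc t) \<omega> = F *v xh t \<omega> + (H *v (x t \<omega> - xh t \<omega>) + L *v v t \<omega>)"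
        by (simp add: step F_def H_def algebra_simps flip: matrix_vector_mul_assoc)
    qed (fact assms)+
    show ?thesis
      using covariance_limits[OF stable kalman_gain_identities[OF assms(5,9,10), folded G_def H_def]
          S[unfolded R_def]]
      by simp
  qed
  moreover have "S' = S" if "estimate_lyapunov A B C K L E V S'" for S'
    using lyapunov_unique[OF stable(1) S] that by (simp only: lyap)
  moreover have "pos_def (S + E)"
    by (rule pos_semidef_add_pos_def[OF Spsd E])
  ultimately show ?thesis
    using Spsd S lyap by blast
qed

end
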